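(* If $x\in l^{\infty}$ is any properly distributed sequence, then $x$ is almost convergent. Moreover, if $\{s_k\}_{k=1}^{\infty}$ is any sequence of simply distributed sequences in $l^\infty$ converging to $x$ in the norm $\|\cdot\|_{\infty}$, then for any Banach limit $L$ it holds that $\lim_{k\to\infty}L(s_k)=L(x)$.
   Context: $l^{\infty}$ is the Banach space of bounded real sequences $x=\{x(n)\}_{n=1}^{\infty}$ with norm $\|x\|_{\infty}=\sup_n|x(n)|$. A Banach limit is a bounded linear functional $L$ on $l^{\infty}$ such that: (a) $L(x)\ge 0$ whenever $x(n)\ge 0$ for all $n$; (b) $L(x)=L(Tx)$ where $Tx=\{x(2),x(3),\ldots\}$; (c) $L(1)=1$ where $1=\{1,1,\ldots\}$; (d) $\|L\|=1$; (e) $L(x)=\lim_{n\to\infty}x(n)$ if $x$ converges. A sequence $x\in l^\infty$ is almost convergent if $L(x)$ has the same value for all Banach limits $L$. $A(E)$ denotes the cardinality of a set $E$, and $\mathbb{N}=\{1,2,\ldots\}$. A sequence $x\in l^{\infty}$ is called properly distributed if for every Borel subset $S$ of $[-\|x\|_{\infty},\|x\|_{\infty}]$ $$w(x,S)=\liminf_{n\to\infty}\frac{A(\{k: x(k+i)\in S,\ k=0,1,\ldots,n-1\})}{n}=\limsup_{n\to\infty}\frac{A(\{k: x(k+i)\in S,\ k=0,1,\ldots,n-1\})}{n}$$ exists uniformly in $i\in\mathbb{N}$, i.e. the quotient converges as $n\to\infty$, uniformly in $i$, to a number $w(x,S)$ independent of $i$. A sequence $s\in l^{\infty}$ is called simply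 distributed if it takes finitely many values, with range $\{a_1,\ldots,a_m\}$, and for each $j=1,\ldots,m$ the quotient $\frac1n A(\{k: s(k+i)=a_j,\ k=0,1,\ldots,n-1\})$ converges as $n\to\infty$, uniformly in $i\in\mathbb{N}$, to a number $w(s,a_j)$ independent of $i$. *)

theory Defs
  imports "HOL-Analysis.Analysis"
begin

text \<open>
  The type \<^typ>\<open>nat \<Rightarrow>\<^sub>C real\<close> is the Banach space of bounded real sequences with the supremum
  norm, since every function on the discrete space \<^typ>\<open>nat\<close> is continuous. Sequences are
  indexed from 0: the mathematical term \<open>x(n)\<close> for \<open>n = 1, 2, \<dots>\<close> is the value at \<open>n - 1\<close>, so that
  the offset \<open>i = 1, 2, \<dots>\<close> in \<open>x(k+i)\<close> becomes an arbitrary \<^typ>\<open>nat\<close>.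
\<close>

type_synonym linf = "nat \<Rightarrow>\<^sub>C real"

definition shift :: "linf \<Rightarrow> linf" where
  "shift x = Bcontfun (\<lambda>n. x (Suc n))"

lemma apply_shift [simp]: "apply_bcontfun (shift x) n = x (Suc n)"
proof -
  have "(\<lambda>n. x (Suc n)) \<in> bcontfun"
    using bounded_apply_bcontfun[of x] by (auto simp: bcontfun_def intro: bounded_subset)
  then show ?thesis
    by (simp add: shift_def Bcontfun_inverse)
qed

definition banach_limit :: "(linf \<Rightarrow>\<^sub>L real) \<Rightarrow> bool" where
  "banach_limit L \<longleftrightarrow>
     (\<forall>x. (\<forall>n. 0 \<le> apply_bcontfun x n) \<longrightarrow> 0 \<le> L x) \<and>
     (\<forall>x. L x = L (shift x)) \<and>
     L (const_bcontfun 1) = 1 \<and>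
     norm L = 1 \<and>
     (\<forall>x. convergent (apply_bcontfun x) \<longrightarrow> L x = lim (apply_bcontfun x))"

definition almost_convergent :: "linf \<Rightarrow> bool" where
  "almost_convergent x \<longleftrightarrow> (\<exists>c. \<forall>L. banach_limit L \<longrightarrow> L x = c)"

definition visit_freq :: "linf \<Rightarrow> real set \<Rightarrow> nat \<Rightarrow> nat \<Rightarrow> real" where
  "visit_freq x S n i = real (card {k. k < n \<and> x (k + i) \<in> S}) / real n"

text \<open>
  The frequencies of visits to \<open>S\<close> converge, uniformly in the offset \<open>i\<close>, to the number \<open>w\<close>,
  which does not depend on \<open>i\<close>.
\<close>

definition has_uniform_freq :: "linf \<Rightarrow> real set \<Rightarrow> real \<Rightarrow> bool" where
  "has_uniform_freq x S w \<longleftrightarrow> uniform_limit UNIV (visit_freq x S) (\<lambda>i. w) sequentially"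

definition properly_distributed :: "linf \<Rightarrow> bool" where
  "properly_distributed x \<longleftrightarrow>
     (\<forall>S \<in> sets borel. S \<subseteq> {- norm x .. norm x} \<longrightarrow> (\<exists>w. has_uniform_freq x S w))"

definition simply_distributed :: "linf \<Rightarrow> bool" where
  "simply_distributed s \<longleftrightarrow>
     finite (range s) \<and> (\<forall>a \<in> range s. \<exists>w. has_uniform_freq s {a} w)"

end

theory Submission
  imports Defs
begin

text \<open>
  A Banach limit \<open>L\<close> is invariant under the shift, so it gives a sequence \<open>y\<close> the same value as
  each of its moving averages \<open>i \<mapsto> (y i + \<dots> + y (i + n - 1)) / n\<close>. If these averages tend to a
  constant \<open>w\<close> uniformly in \<open>i\<close>, they tend to it in the norm of the sequence space, and continuity
  of \<open>L\<close> gives \<open>L y = w\<close>: this is \<open>banach_limit_eq_uniform_average\<close>, the easy half of Lorentz's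
  characterisation of almost convergence. For the indicator sequence of the visits of \<open>x\<close> to a
  Borel set \<open>S\<close>, the moving averages are the frequencies of visits. Proper distribution of \<open>x\<close>
  therefore makes all Banach limits agree on each of these indicator sequences, hence on their
  linear combinations.

  Rounding the terms of \<open>x\<close> down to multiples of \<open>e\<close> produces such a linear combination at distance
  at most \<open>e\<close> from \<open>x\<close> (\<open>exists_simple_approximation\<close>). Since \<open>e\<close> is arbitrary and Banach limits are
  bounded, all of them agree on \<open>x\<close> itself. The convergence \<open>L (s k) \<longlonglongrightarrow> L x\<close> is the continuity
  of \<open>L\<close>.
\<close>

lemma apply_bcontfun_sum:
  fixes f :: "'b \<Rightarrow> 'a::topological_space \<Rightarrow>\<^sub>C 'c::real_normed_vector"
  shows "apply_bcontfun (\<Sum>j\<in>J. f j) t = (\<Sum>j\<in>J. apply_bcontfun (f j) t)"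
  by (induction J rule: infinite_finite_induct) (simp_all add: plus_bcontfun.rep_eq)

lemma apply_shift_funpow: "apply_bcontfun ((shift ^^ k) y) n = y (k + n)"
  by (induction k arbitrary: n) simp_all

lemma banach_limit_shift_funpow:
  assumes "banach_limit L"
  shows "L ((shift ^^ k) y) = L y"
proof (induction k)
  case (Suc k)
  then show ?case
    using assms unfolding banach_limit_def by (metis funpow.simps(2) o_apply)
qed simp

lemma banach_limit_const:
  assumes "banach_limit L"
  shows "L (const_bcontfun c) = c"
proof -
  have "const_bcontfun c = c *\<^sub>R (const_bcontfun 1 :: linf)"
    by (intro bcontfun_eqI) (simp add: scaleR_bcontfun.rep_eq const_bcontfun.rep_eq)
  then show ?thesis
    using assms by (simp add: banach_limit_def blinfun.scaleR_right)
qed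

definition moving_average :: "nat \<Rightarrow> linf \<Rightarrow> linf" where
  "moving_average n y = (1 / real n) *\<^sub>R (\<Sum>k<n. (shift ^^ k) y)"

lemma apply_moving_average: "apply_bcontfun (moving_average n y) i = (\<Sum>k<n. y (k + i)) / real n"
  by (simp add: moving_average_def scaleR_bcontfun.rep_eq apply_bcontfun_sum apply_shift_funpow)

lemma banach_limit_moving_average:
  assumes "banach_limit L" "n > 0"
  shows "L (moving_average n y) = L y"
  using assms
  by (simp add: moving_average_def blinfun.scaleR_right blinfun.sum_right banach_limit_shift_funpow)

lemma banach_limit_eq_uniform_average:
  fixes y :: linf
  assumes L: "banach_limit L"
    and lim: "uniform_limit UNIV (\<lambda>n i. (\<Sum>k<n. y (k + i)) / real n) (\<lambda>i. w) sequentially"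
  shows "L y = w"
proof -
  have "(\<lambda>n. moving_average n y) \<longlonglongrightarrow> const_bcontfun w"
  proof (rule tendstoI)
    fix e :: real assume "e > 0"
    have "\<forall>\<^sub>F n in sequentially. \<forall>i. dist ((\<Sum>k<n. y (k + i)) / real n) w < e / 2"
      using uniform_limitD[OF lim, of "e / 2"] \<open>e > 0\<close> by simp
    then show "\<forall>\<^sub>F n in sequentially. dist (moving_average n y) (const_bcontfun w) < e"
    proof eventually_elim
      case (elim n)
      have "dist (moving_average n y) (const_bcontfun w) \<le> e / 2"
        using elim
        by (intro dist_bound) (simp add: apply_moving_average const_bcontfun.rep_eq less_imp_le)
      then show ?case using \<open>e > 0\<close> by simp
    qed
  qed
  then have "(\<lambda>n. L (moving_average n y)) \<longlonglongrightarrow> w"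
    using blinfun.tendsto[OF tendsto_const] banach_limit_const[OF L, of w] by metis
  \<comment> \<open>For \<open>n = 0\<close> the average is \<open>0\<close>, so the sequence is only eventually constant.\<close>
  moreover have "\<forall>\<^sub>F n in sequentially. L (moving_average n y) = L y"
    using eventually_gt_at_top[of "0::nat"]
    by eventually_elim (simp add: banach_limit_moving_average[OF L])
  then have "(\<lambda>n. L (moving_average n y)) \<longlonglongrightarrow> L y"
    by (rule tendsto_eventually)
  ultimately show ?thesis
    using LIMSEQ_unique by blast
qed

definition visit_indicator :: "linf \<Rightarrow> real set \<Rightarrow> linf" where
  "visit_indicator x S = Bcontfun (\<lambda>n. indicator S (x n))"

lemma apply_visit_indicator [simp]:
  "apply_bcontfun (visit_indicator x S) n = indicator S (x n)"
proof -
  have "(\<lambda>n. indicator S (x n) :: real) \<in> bcontfun"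
    by (auto simp: bcontfun_def bounded_iff indicator_def intro!: exI[of _ 1])
  then show ?thesis
    by (simp add: visit_indicator_def Bcontfun_inverse)
qed

lemma visit_freq_eq_average:
  "visit_freq x S n i = (\<Sum>k<n. apply_bcontfun (visit_indicator x S) (k + i)) / real n"
proof -
  have "{k. k < n \<and> x (k + i) \<in> S} = {k \<in> {..<n}. x (k + i) \<in> S}"
    by auto
  then show ?thesis
    by (simp add: visit_freq_def indicator_def sum.If_cases Int_def)
qed

lemma banach_limit_visit_indicator:
  assumes "banach_limit L" "has_uniform_freq x S w"
  shows "L (visit_indicator x S) = w"
proof (rule banach_limit_eq_uniform_average[OF assms(1)])
  show "uniform_limit UNIV
      (\<lambda>n i. (\<Sum>k<n. apply_bcontfun (visit_indicator x S) (k + i)) / real n) (\<lambda>i. w) sequentially"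
    using assms(2) unfolding has_uniform_freq_def visit_freq_eq_average[abs_def] .
qed

text \<open>
  The sets on which \<open>t \<mapsto> e * \<lfloor>t / e\<rfloor>\<close> is constant are Borel, and finitely many of them cover the
  bounded range of \<open>x\<close>. They are cut down to \<open>{- norm x .. norm x}\<close> because proper distribution
  only speaks about subsets of that interval.
\<close>

lemma exists_simple_approximation:
  fixes x :: linf and e :: real
  assumes "e > 0"
  shows "\<exists>y \<in> span (visit_indicator x ` {S \<in> sets borel. S \<subseteq> {- norm x .. norm x}}). dist x y \<le> e"
proof
  let ?S = "\<lambda>j::int. {t \<in> {- norm x .. norm x}. \<lfloor>t / e\<rfloor> = j}"
  let ?J = "{\<lfloor>- norm x / e\<rfloor> .. \<lfloor>norm x / e\<rfloor>}"
  let ?a = "\<lambda>j. e * of_int j"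
  have "?S j \<in> sets borel" for j
    by measurable
  then show "(\<Sum>j\<in>?J. ?a j *\<^sub>R visit_indicator x (?S j))
      \<in> span (visit_indicator x ` {S \<in> sets borel. S \<subseteq> {- norm x .. norm x}})"
    by (intro span_sum span_scale span_base imageI) auto
  show "dist x (\<Sum>j\<in>?J. ?a j *\<^sub>R visit_indicator x (?S j)) \<le> e"
  proof (rule dist_bound)
    fix n
    have range: "- norm x \<le> x n" "x n \<le> norm x"
      using norm_bounded[of x n] by (auto simp: abs_le_iff)
    then have "- norm x / e \<le> x n / e" "x n / e \<le> norm x / e"
      using assms by (blast intro: divide_right_mono less_imp_le)+
    then have "\<lfloor>x n / e\<rfloor> \<in> ?J"
      using floor_mono by (metis atLeastAtMost_iff)
    have "apply_bcontfun (\<Sum>j\<in>?J. ?a j *\<^sub>R visit_indicator x (?S j)) n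
        = (\<Sum>j\<in>?J. if j = \<lfloor>x n / e\<rfloor> then ?a j else 0)"
      unfolding apply_bcontfun_sum
      using range by (intro sum.cong) (auto simp: scaleR_bcontfun.rep_eq)
    also have "\<dots> = e * \<lfloor>x n / e\<rfloor>"
      using \<open>\<lfloor>x n / e\<rfloor> \<in> ?J\<close> by (simp only: sum.delta finite_atLeastAtMost_int if_True)
    finally have val: "apply_bcontfun (\<Sum>j\<in>?J. ?a j *\<^sub>R visit_indicator x (?S j)) n = e * \<lfloor>x n / e\<rfloor>" .
    have "e * \<lfloor>x n / e\<rfloor> \<le> x n" "x n \<le> e * \<lfloor>x n / e\<rfloor> + e"
      using assms floor_divide_lower[of e "x n"] floor_divide_upper[of e "x n"]
      by (auto simp: algebra_simps)
    then show "dist (x n) (apply_bcontfun (\<Sum>j\<in>?J. ?a j *\<^sub>R visit_indicator x (?S j)) n) \<le> e"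
      unfolding val dist_real_def by linarith
  qed
qed

lemma banach_limit_dist_le:
  assumes "banach_limit L"
  shows "dist (L x) (L y) \<le> dist x y"
proof -
  have "norm (L (x - y)) \<le> norm L * norm (x - y)"
    by (rule norm_blinfun)
  with assms show ?thesis
    by (simp add: banach_limit_def dist_norm blinfun.diff_right)
qed

lemma properly_distributed_banach_limits_eq:
  assumes x: "properly_distributed x" and L: "banach_limit L" and M: "banach_limit M"
  shows "L x = M x"
proof -
  have "dist (L x) (M x) \<le> d" if "d > 0" for d
  proof -
    let ?V = "visit_indicator x ` {S \<in> sets borel. S \<subseteq> {- norm x .. norm x}}"
    obtain y where y: "y \<in> span ?V" and approx: "dist x y \<le> d / 2"
      using exists_simple_approximation[OF half_gt_zero[OF \<open>d > 0\<close>], of x] by blast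
    have "L v = M v" if "v \<in> ?V" for v
    proof -
      obtain S w where "v = visit_indicator x S" "has_uniform_freq x S w"
        using x \<open>v \<in> ?V\<close> unfolding properly_distributed_def by blast
      then show ?thesis
        using banach_limit_visit_indicator L M by metis
    qed
    moreover have "linear (blinfun_apply L)" "linear (blinfun_apply M)"
      by (simp_all add: bounded_linear.linear blinfun.bounded_linear_right)
    ultimately have "L y = M y"
      using linear_eq_on_span[of L M ?V y] y by blast
    moreover have "dist (L x) (L y) \<le> d / 2" "dist (M x) (M y) \<le> d / 2"
      using approx banach_limit_dist_le[OF L, of x y] banach_limit_dist_le[OF M, of x y]
      by simp_all
    ultimately show ?thesis
      using dist_triangle2[of "L x" "M x" "L y"] by simp
  qed
  then have "dist (L x) (M x) \<le> 0"
    by (rule field_le_epsilon) simp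
  then show ?thesis
    by simp
qed

theorem theorem2p6:
  fixes x :: linf
  assumes "properly_distributed x"
  shows "almost_convergent x \<and>
    (\<forall>s :: nat \<Rightarrow> linf. (\<forall>k. simply_distributed (s k)) \<longrightarrow> s \<longlonglongrightarrow> x \<longrightarrow>
      (\<forall>L. banach_limit L \<longrightarrow> (\<lambda>k. L (s k)) \<longlonglongrightarrow> L x))"
proof (intro conjI allI impI)
  \<comment> \<open>Any Banach limit can supply the common value; choosing one makes the witness independent of \<open>L\<close>.\<close>
  have "L x = (SOME M. banach_limit M) x" if "banach_limit L" for L
    by (rule properly_distributed_banach_limits_eq[OF assms that someI[of banach_limit, OF that]])
  then show "almost_convergent x"
    unfolding almost_convergent_def by (intro exI allI impI)
next
  fix s :: "nat \<Rightarrow> linf" and L :: "linf \<Rightarrow>\<^sub>L real"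
  assume "s \<longlonglongrightarrow> x"
  then show "(\<lambda>k. L (s k)) \<longlonglongrightarrow> L x"
    by (rule blinfun.tendsto[OF tendsto_const])
qed

end
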